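(* Let $p\ge 1$, let $\mu^d,\nu^d\in\mathcal{P}(\mathbb{R}^d)$ have $k$-dimensional effective structure with semi-orthogonal matrix $U\in\mathbb{R}^{d\times k}$ (as defined in the context), and let $\mu^k,\nu^k\in\mathcal{P}(\mathbb{R}^k)$ be the pushforwards of $\mu^d,\nu^d$ under $x\mapsto U^\top x$. For $\theta^d\in\mathbb{S}^{d-1}$ set $\theta^k=\frac{U^\top\theta^d}{\|U^\top\theta^d\|}$, with the convention $\theta^k=0_k$ if $\|U^\top\theta^d\|=0$. Then for every $\theta^d\in\mathbb{S}^{d-1}$, $$W_p^p(\theta^d_\#\mu^d,\theta^d_\#\nu^d)=W_p^p\big((U^\top\theta^d)_\#\mu^k,(U^\top\theta^d)_\#\nu^k\big)=\|U^\top\theta^d\|^p\,W_p^p(\theta^k_\#\mu^k,\theta^k_\#\nu^k).$$ Furthermore, for all $L\ge1$ and all $\theta^d_1,\dots,\theta^d_L\in\mathbb{S}^{d-1}$, with $\theta^k_l=\frac{U^\top\theta^d_l}{\|U^\top\theta^d_l\|}$ if $\|U^\top\theta^d_l\|\neq 0$ and $\theta^k_l=0_k$ if $\|U^\top\theta^d_l\|=0$ ($l=1,\dots,L$), $$SW_p^p\Big(\mu^k,\nu^k;\tfrac1L\sum_{l=1}^L\delta_{\theta^k_l}\Big)=\widetilde{SW}_p^p\Big(\mu^d,\nu^d;\tfrac1L\sum_{l=1}^L\delta_{\theta^d_l},\rho\Big),$$ and $$SW_p^p(\mu^k,\nu^k)=\widetilde{SW}_p^p\big(\mu^d,\nu^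d;\mathcal{U}(\mathbb{S}^{d-1}),\rho\big).$$
   Context: $\mathcal{P}(\mathbb{R}^m)$ is the set of Borel probability measures on $\mathbb{R}^m$; $\mathbb{S}^{m-1}$ is the Euclidean unit sphere in $\mathbb{R}^m$; $\mathcal{U}(\mathbb{S}^{m-1})$ is the uniform probability measure on it; $0_k$ is the zero vector of $\mathbb{R}^k$. For $\theta\in\mathbb{R}^m$ and $\mu\in\mathcal{P}(\mathbb{R}^m)$, $\theta_\#\mu$ is the pushforward of $\mu$ under $x\mapsto\theta^\top x$. $W_p$ is the $p$-Wasserstein distance, $W_p^p(\mu,\nu)=\inf_{\gamma}\int\|x-y\|^p\,d\gamma(x,y)$ over couplings $\gamma$ of $\mu,\nu$ (Euclidean norm). For a probability measure $\sigma$ of slicing directions in $\mathbb{R}^m$, $SW_p^p(\mu,\nu;\sigma)=\int W_p^p(\theta_\#\mu,\theta_\#\nu)\,d\sigma(\theta)$, and $SW_p^p(\mu,\nu):=SW_p^p(\mu,\nu;\mathcal{U}(\mathbb{S}^{m-1}))$. Rescaled sliced-Wasserstein: for $\sigma\in\mathcal{P}(\mathbb{S}^{d-1})$, $\widetilde{SW}_p^p(\mu,\nu;\sigma,\rho)=\int_{\mathbb{S}^{d-1}}\rho(\phi_U(\theta))\,W_p^p(\theta_\#\mu,\theta_\#\nu)\,d\sigma(\theta)$, where $\phi_U(\theta)=\|U^\top\theta\|$ and $\rho(r)=r^{-p}$ for $r>0$, $\rho(0)=0$ (equivalently the convention $\frac10\cdot0=0$ is used). Effective subspace structure: $(\mu^d,\nu^d)$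 has $k$-dimensional effective structure ($k$ a positive integer, $k\le d$) if: (1) there is $U\in\mathbb{R}^{d\times k}$ with $U^\top U=I_k$ such that $\mathrm{supp}(\mu^d),\mathrm{supp}(\nu^d)\subset V_k:=\text{column span of }U$; (2) $k$ is minimal, i.e. no such matrix with fewer than $k$ columns satisfies (1); (3) for all measurable $A\subset\mathbb{R}^d$, $\mu^d(A)=\mu^d(P_{V_k}^{-1}(A))$ and $\nu^d(A)=\nu^d(P_{V_k}^{-1}(A))$, where $P_{V_k}(x)=UU^\top x$; (4) $W_p(\mu^k,\nu^k)<\infty$, where $\mu^k,\nu^k$ are the pushforwards of $\mu^d,\nu^d$ under $x\mapsto U^\top x$. *)

theory Defs
  imports "HOL-Probability.Probability"
begin

text \<open>
  Borel probability measures on a Euclidean space are the elements of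
  \<open>space (prob_algebra borel)\<close>. Costs and distances take values in \<open>ennreal\<close>, since no
  moment assumption is made on the individual measures.
\<close>

definition supp :: "'a::topological_space measure \<Rightarrow> 'a set" where
  "supp \<mu> = {x. \<forall>S. open S \<longrightarrow> x \<in> S \<longrightarrow> emeasure \<mu> S > 0}"

definition couplings :: "'a::euclidean_space measure \<Rightarrow> 'a measure \<Rightarrow> ('a \<times> 'a) measure set" where
  "couplings \<mu> \<nu> = {\<gamma> \<in> space (prob_algebra (borel \<Otimes>\<^sub>M borel)).
     distr \<gamma> borel fst = \<mu> \<and> distr \<gamma> borel snd = \<nu>}"

text \<open>\<open>wasserstein_pow p\<close> is $W_p^p$, and \<open>wasserstein p\<close> is $W_p$, its $p$-th root.\<close>

definition wasserstein_pow ::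
  "real \<Rightarrow> 'a::euclidean_space measure \<Rightarrow> 'a measure \<Rightarrow> ennreal" where
  "wasserstein_pow p \<mu> \<nu> =
     (INF \<gamma>\<in>couplings \<mu> \<nu>. \<integral>\<^sup>+ z. ennreal (norm (fst z - snd z) powr p) \<partial>\<gamma>)"

definition wasserstein ::
  "real \<Rightarrow> 'a::euclidean_space measure \<Rightarrow> 'a measure \<Rightarrow> ennreal" where
  "wasserstein p \<mu> \<nu> =
     (if wasserstein_pow p \<mu> \<nu> = \<infinity> then \<infinity>
      else ennreal (enn2real (wasserstein_pow p \<mu> \<nu>) powr (1 / p)))"

definition slice :: "real ^ 'm \<Rightarrow> (real ^ 'm) measure \<Rightarrow> real measure" where
  "slice \<theta> \<mu> = distr \<mu> borel (\<lambda>x. \<theta> \<bullet> x)"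

definition sliced_wasserstein_pow ::
  "real \<Rightarrow> (real ^ 'm) measure \<Rightarrow> (real ^ 'm) measure \<Rightarrow> (real ^ 'm) measure \<Rightarrow> ennreal" where
  "sliced_wasserstein_pow p \<mu> \<nu> \<sigma> =
     (\<integral>\<^sup>+ \<theta>. wasserstein_pow p (slice \<theta> \<mu>) (slice \<theta> \<nu>) \<partial>\<sigma>)"

definition rescaled_sliced_wasserstein_pow ::
  "real \<Rightarrow> real ^ 'k ^ 'd \<Rightarrow> (real ^ 'd) measure \<Rightarrow> (real ^ 'd) measure \<Rightarrow>
   (real ^ 'd) measure \<Rightarrow> (real \<Rightarrow> real) \<Rightarrow> ennreal" where
  "rescaled_sliced_wasserstein_pow p U \<mu> \<nu> \<sigma> \<rho> =
     (\<integral>\<^sup>+ \<theta>\<in>sphere 0 1. ennreal (\<rho> (norm (transpose U *v \<theta>)))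
         * wasserstein_pow p (slice \<theta> \<mu>) (slice \<theta> \<nu>) \<partial>\<sigma>)"

definition rescaling :: "real \<Rightarrow> real \<Rightarrow> real" where
  "rescaling p r = (if r > 0 then r powr (- p) else 0)"

text \<open>
  The uniform probability measure on the unit sphere, regarded as a Borel measure on the ambient
  space: the radial projection of the uniform distribution on the unit ball (the normalised cone
  measure, which coincides with the normalised surface measure). The centre of the ball, sent to
  \<open>0\<close>, is a null set.
\<close>

definition uniform_sphere :: "(real ^ 'm) measure" where
  "uniform_sphere = distr (uniform_measure lborel (ball 0 1)) borel (\<lambda>x. x /\<^sub>R norm x)"

text \<open>The measure $\frac1L\sum_{l=1}^L\delta_{x_l}$, cf. \<open>emeasure_empirical\<close> below.\<close>

definition empirical :: "nat \<Rightarrow> (nat \<Rightarrow> 'a::topological_space) \<Rightarrow> 'a measure" where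
  "empirical L x = distr (uniform_count_measure {1..L}) borel x"

lemma emeasure_empirical:
  assumes "L \<ge> 1" and "A \<in> sets borel"
  shows "emeasure (empirical L x) A =
    ennreal (1 / real L) * (\<Sum>l = 1..L. emeasure (return borel (x l)) A)"
proof -
  have eq: "emeasure (empirical L x) A =
      emeasure (uniform_count_measure {1..L}) (x -` A \<inter> {1..L})"
  proof -
    have "x \<in> measurable (uniform_count_measure {1..L}) borel"
      by (simp add: measurable_def space_uniform_count_measure sets_uniform_count_measure)
    then show ?thesis
      unfolding empirical_def using assms(2)
      by (simp add: emeasure_distr space_uniform_count_measure)
  qed
  have sum_eq: "(\<Sum>l = 1..L. emeasure (return borel (x l)) A) = of_nat (card (x -` A \<inter> {1..L}))"
  proof -
    have "(\<Sum>l = 1..L. emeasure (return borel (x l)) A) =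
        (\<Sum>l = 1..L. if l \<in> x -` A then 1 else 0 :: ennreal)"
      using assms(2) by (intro sum.cong) (simp_all add: indicator_def)
    also have "\<dots> = of_nat (card ({1..L} \<inter> x -` A))"
      by (subst sum.inter_restrict [symmetric]) simp_all
    finally show ?thesis
      by (simp only: Int_commute)
  qed
  have "emeasure (empirical L x) A = ennreal (real (card (x -` A \<inter> {1..L})) / real L)"
    unfolding eq by (subst emeasure_uniform_count_measure) simp_all
  also have "\<dots> = ennreal (1 / real L * real (card (x -` A \<inter> {1..L})))"
    by simp
  also have "\<dots> = ennreal (1 / real L) * of_nat (card (x -` A \<inter> {1..L}))"
    by (subst ennreal_mult) (simp_all only: ennreal_of_nat_eq_real_of_nat, simp_all)
  finally show ?thesis
    unfolding sum_eq .
qed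

text \<open>
  A semi-orthogonal matrix with \<open>j\<close> columns whose column span contains both supports. Minimality of the dimension quantifies over the
  number of columns, so such a matrix is given by its columns \<open>C 0, \<dots>, C (j - 1)\<close>: the first
  conjunct is $C^\top C = I_j$, and the span is the column span.
\<close>

definition semi_orthogonal_carrier ::
  "(real ^ 'd) measure \<Rightarrow> (real ^ 'd) measure \<Rightarrow> nat \<Rightarrow> (nat \<Rightarrow> real ^ 'd) \<Rightarrow> bool" where
  "semi_orthogonal_carrier \<mu> \<nu> j C \<longleftrightarrow>
     (\<forall>a<j. \<forall>b<j. C a \<bullet> C b = (if a = b then 1 else 0)) \<and>
     supp \<mu> \<subseteq> span (C ` {..<j}) \<and> supp \<nu> \<subseteq> span (C ` {..<j})"

definition project_coords :: "real ^ 'k ^ 'd \<Rightarrow> (real ^ 'd) measure \<Rightarrow> (real ^ 'k) measure" where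
  "project_coords U \<mu> = distr \<mu> borel (\<lambda>x. transpose U *v x)"

text \<open>
  The effective dimension is \<open>CARD('k)\<close>; it is positive, and \<open>CARD('k) \<le> CARD('d)\<close> follows
  from the first conjunct. As the dimension is a positive integer, minimality ranges over matrices
  with at least one column.
\<close>

definition effective_structure ::
  "real \<Rightarrow> (real ^ 'd) measure \<Rightarrow> (real ^ 'd) measure \<Rightarrow> real ^ 'k ^ 'd \<Rightarrow> bool" where
  "effective_structure p \<mu> \<nu> U \<longleftrightarrow>
     transpose U ** U = mat 1 \<and>
     supp \<mu> \<subseteq> span (columns U) \<and> supp \<nu> \<subseteq> span (columns U) \<and>
     (\<forall>j. 1 \<le> j \<and> j < CARD('k) \<longrightarrow> (\<nexists>C. semi_orthogonal_carrier \<mu> \<nu> j C)) \<and>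
     (\<forall>A\<in>sets borel.
        emeasure \<mu> A = emeasure \<mu> ((\<lambda>x. U *v (transpose U *v x)) -` A) \<and>
        emeasure \<nu> A = emeasure \<nu> ((\<lambda>x. U *v (transpose U *v x)) -` A)) \<and>
     wasserstein p (project_coords U \<mu>) (project_coords U \<nu>) < \<infinity>"

definition project_direction :: "real ^ 'k ^ 'd \<Rightarrow> real ^ 'd \<Rightarrow> real ^ 'k" where
  "project_direction U \<theta> =
     (if norm (transpose U *v \<theta>) = 0 then 0
      else (transpose U *v \<theta>) /\<^sub>R norm (transpose U *v \<theta>))"

end

theory Submission
  imports Defs
begin

text \<open>
  By invariance of \<open>\<mu>\<close> under the projection $UU^\top$, slicing \<open>\<mu>\<close> along $\theta$ is slicing its
  coordinate measure along $U^\top\theta$, and homogeneity of $W_p^p$ under dilations does the rest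
  of the pointwise claim; the factor $\rho$ cancels exactly the power of $\|U^\top\theta\|$.
  For the uniform measures it remains to see that $U^\top\theta/\|U^\top\theta\|$ is uniform. Both
  uniform measures are the laws of directions of standard Gaussian vectors, and $U^\top$ maps the
  Gaussian measure to the Gaussian measure. Whether $\theta\mapsto W_p^p(\theta_\#\mu,\theta_\#\nu)$ is
  measurable is never decided: \<open>nn_integral\<close> of an arbitrary function is a lower integral, and
  lower integrals may be transported along a map whose fibres carry a measurable disintegration.
\<close>

section \<open>Lower integrals under pushforwards\<close>

text \<open>Since \<open>F\<close> is arbitrary, only one inequality survives: a simple minorant of
  \<open>F\<close> composed with \<open>T\<close> is a measurable minorant of \<open>F\<close> after
  \<open>T\<close>, but a minorant of the latter need not factor through \<open>T\<close>.\<close>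

lemma nn_integral_distr_le:
  assumes T: "T \<in> measurable M N"
  shows "(\<integral>\<^sup>+ y. F y \<partial>distr M N T) \<le> (\<integral>\<^sup>+ x. F (T x) \<partial>M)"
  unfolding nn_integral_def[of "distr M N T"]
proof (rule SUP_least, clarify)
  fix g assume g: "simple_function (distr M N T) g" "g \<le> F"
  then have [measurable]: "g \<in> borel_measurable N"
    by (auto dest: borel_measurable_simple_function)
  have "integral\<^sup>S (distr M N T) g = (\<integral>\<^sup>+ y. g y \<partial>distr M N T)"
    using g(1) by (rule nn_integral_eq_simple_integral[symmetric])
  also have "\<dots> = (\<integral>\<^sup>+ x. g (T x) \<partial>M)"
    by (rule nn_integral_distr[OF T]) simp
  also have "\<dots> \<le> (\<integral>\<^sup>+ x. F (T x) \<partial>M)"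
    using g(2) by (intro nn_integral_mono) (auto simp: le_fun_def)
  finally show "integral\<^sup>S (distr M N T) g \<le> (\<integral>\<^sup>+ x. F (T x) \<partial>M)" .
qed

text \<open>
  Both sides are lower integrals: a measurable minorant \<open>h\<close> of \<open>F \<circ> T\<close> is averaged over the
  fibres of \<open>T\<close> by means of \<open>s\<close>, which yields a measurable minorant of \<open>F\<close> with the same integral.
\<close>

lemma nn_integral_distr_section:
  assumes T: "T \<in> measurable M N" and N: "distr M N T = N"
    and P: "prob_space P"
    and s[measurable]: "s \<in> measurable (N \<Otimes>\<^sub>M P) M" and M: "distr (N \<Otimes>\<^sub>M P) M s = M"
    and section_of: "AE y in N. AE w in P. T (s (y, w)) = y"
  shows "(\<integral>\<^sup>+ x. F (T x) \<partial>M) = (\<integral>\<^sup>+ y. F y \<partial>N)"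
proof (rule antisym)
  interpret P: prob_space P by (rule P)
  show "(\<integral>\<^sup>+ y. F y \<partial>N) \<le> (\<integral>\<^sup>+ x. F (T x) \<partial>M)"
    using nn_integral_distr_le[OF T, of F] by (simp add: N)
  show "(\<integral>\<^sup>+ x. F (T x) \<partial>M) \<le> (\<integral>\<^sup>+ y. F y \<partial>N)"
    unfolding nn_integral_def[of M]
  proof (rule SUP_least, clarify)
    fix h assume h: "simple_function M h" "h \<le> (\<lambda>x. F (T x))"
    then have [measurable]: "h \<in> borel_measurable M"
      by (auto dest: borel_measurable_simple_function)
    have "integral\<^sup>S M h = (\<integral>\<^sup>+ x. h x \<partial>distr (N \<Otimes>\<^sub>M P) M s)"
      using h(1) by (simp add: M nn_integral_eq_simple_integral)
    also have "\<dots> = (\<integral>\<^sup>+ z. h (s z) \<partial>(N \<Otimes>\<^sub>M P))"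
      by (rule nn_integral_distr) measurable
    also have "\<dots> = (\<integral>\<^sup>+ y. \<integral>\<^sup>+ w. h (s (y, w)) \<partial>P \<partial>N)"
      by (rule P.nn_integral_fst[symmetric]) measurable
    also have "\<dots> \<le> (\<integral>\<^sup>+ y. F y \<partial>N)"
      using section_of
    proof (intro nn_integral_mono_AE, eventually_elim)
      fix y assume *: "AE w in P. T (s (y, w)) = y"
      have "(\<integral>\<^sup>+ w. h (s (y, w)) \<partial>P) \<le> (\<integral>\<^sup>+ w. F y \<partial>P)"
        using * by (intro nn_integral_mono_AE, eventually_elim) (metis h(2) le_funD)
      then show "(\<integral>\<^sup>+ w. h (s (y, w)) \<partial>P) \<le> F y"
        by (simp add: P.emeasure_space_1)
    qed
    finally show "integral\<^sup>S M h \<le> (\<integral>\<^sup>+ y. F y \<partial>N)" .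
  qed
qed

text \<open>Measurability of \<open>F\<close> is avoided because the empirical measure sits on
  finitely many closed points: changing \<open>F\<close> to 0 off them leaves a finite combination
  of indicators of points.\<close>

lemma nn_integral_empirical:
  fixes x :: "nat \<Rightarrow> 'a::t1_space"
  shows "(\<integral>\<^sup>+ y. F y \<partial>empirical L x) = (\<integral>\<^sup>+ l. F (x l) \<partial>uniform_count_measure {1..L})"
proof -
  let ?S = "x ` {1..L}"
  let ?F = "\<lambda>y. if y \<in> ?S then F y else 0"
  have x: "x \<in> measurable (uniform_count_measure {1..L}) borel"
    by (simp add: measurable_def space_uniform_count_measure sets_uniform_count_measure)
  have eq: "?F = (\<lambda>y. \<Sum>s\<in>?S. F s * indicator {s} y)"
    by (simp add: fun_eq_iff indicator_def sum.delta' if_distrib cong: if_cong)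
  have F: "?F \<in> borel_measurable borel"
    unfolding eq by measurable
  have "AE y in empirical L x. y \<in> ?S"
    unfolding empirical_def
    by (subst AE_distr_iff[OF x])
      (auto intro!: AE_I2 borel_closed finite_imp_closed simp: space_uniform_count_measure)
  then have "(\<integral>\<^sup>+ y. F y \<partial>empirical L x) = (\<integral>\<^sup>+ y. ?F y \<partial>empirical L x)"
    by (intro nn_integral_cong_AE, eventually_elim) simp
  also have "\<dots> = (\<integral>\<^sup>+ l. ?F (x l) \<partial>uniform_count_measure {1..L})"
    unfolding empirical_def using F by (simp add: nn_integral_distr x)
  also have "\<dots> = (\<integral>\<^sup>+ l. F (x l) \<partial>uniform_count_measure {1..L})"
    by (intro nn_integral_cong) (simp add: space_uniform_count_measure)
  finally show ?thesis .
qed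

section \<open>Transport cost under dilations\<close>

text \<open>Dilating both coordinates of a coupling of the original measures couples the dilated
  ones, at \<open>c powr p\<close> times the cost.\<close>

lemma wasserstein_pow_scale_le:
  fixes \<mu> \<nu> :: "'a::euclidean_space measure"
  assumes \<mu>: "sets \<mu> = sets borel" and \<nu>: "sets \<nu> = sets borel" and c: "c > 0"
  shows "wasserstein_pow p (distr \<mu> borel ((*\<^sub>R) c)) (distr \<nu> borel ((*\<^sub>R) c))
    \<le> ennreal (c powr p) * wasserstein_pow p \<mu> \<nu>"
proof -
  let ?S = "\<lambda>z::'a \<times> 'a. (c *\<^sub>R fst z, c *\<^sub>R snd z)"
  have le: "wasserstein_pow p (distr \<mu> borel ((*\<^sub>R) c)) (distr \<nu> borel ((*\<^sub>R) c))
    \<le> ennreal (c powr p) * (\<integral>\<^sup>+ z. ennreal (norm (fst z - snd z) powr p) \<partial>\<gamma>)"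
    if \<gamma>: "\<gamma> \<in> couplings \<mu> \<nu>" for \<gamma>
  proof -
    have [measurable_cong]: "sets \<gamma> = sets (borel \<Otimes>\<^sub>M borel)" and "prob_space \<gamma>"
      and m: "distr \<gamma> borel fst = \<mu>" "distr \<gamma> borel snd = \<nu>"
      using \<gamma> by (auto simp: couplings_def space_prob_algebra)
    interpret prob_space \<gamma> by fact
    have [measurable]: "?S \<in> measurable \<gamma> (borel \<Otimes>\<^sub>M borel)" by measurable
    let ?\<gamma> = "distr \<gamma> (borel \<Otimes>\<^sub>M borel) ?S"
    have "?\<gamma> \<in> couplings (distr \<mu> borel ((*\<^sub>R) c)) (distr \<nu> borel ((*\<^sub>R) c))"
      unfolding couplings_def space_prob_algebra
      by (auto simp: prob_space_distr distr_distr o_def simp flip: m)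
    then have "wasserstein_pow p (distr \<mu> borel ((*\<^sub>R) c)) (distr \<nu> borel ((*\<^sub>R) c))
      \<le> (\<integral>\<^sup>+ z. ennreal (norm (fst z - snd z) powr p) \<partial>?\<gamma>)"
      unfolding wasserstein_pow_def by (rule INF_lower)
    also have "\<dots> = (\<integral>\<^sup>+ z. ennreal (c powr p) * ennreal (norm (fst z - snd z) powr p) \<partial>\<gamma>)"
      using c by (subst nn_integral_distr)
        (auto simp: powr_mult ennreal_mult simp flip: scaleR_diff_right)
    also have "\<dots> = ennreal (c powr p) * (\<integral>\<^sup>+ z. ennreal (norm (fst z - snd z) powr p) \<partial>\<gamma>)"
      by (rule nn_integral_cmult) measurable
    finally show ?thesis .
  qed
  \<comment> \<open>The factor is moved to the left so that the right-hand side is a bare infimum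
    over couplings.\<close>
  have "ennreal (1 / c powr p) * wasserstein_pow p (distr \<mu> borel ((*\<^sub>R) c)) (distr \<nu> borel ((*\<^sub>R) c))
     \<le> wasserstein_pow p \<mu> \<nu>"
    unfolding wasserstein_pow_def[of p \<mu> \<nu>]
  proof (intro INF_greatest)
    fix \<gamma> assume \<gamma>: "\<gamma> \<in> couplings \<mu> \<nu>"
    have "ennreal (1 / c powr p) * wasserstein_pow p (distr \<mu> borel ((*\<^sub>R) c)) (distr \<nu> borel ((*\<^sub>R) c))
      \<le> ennreal (1 / c powr p) * (ennreal (c powr p) * (\<integral>\<^sup>+ z. ennreal (norm (fst z - snd z) powr p) \<partial>\<gamma>))"
      by (intro mult_left_mono le \<gamma>) simp
    also have "\<dots> = (\<integral>\<^sup>+ z. ennreal (norm (fst z - snd z) powr p) \<partial>\<gamma>)"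
      using c by (simp flip: mult.assoc ennreal_mult)
    finally show "ennreal (1 / c powr p) * wasserstein_pow p (distr \<mu> borel ((*\<^sub>R) c)) (distr \<nu> borel ((*\<^sub>R) c))
      \<le> (\<integral>\<^sup>+ z. ennreal (norm (fst z - snd z) powr p) \<partial>\<gamma>)" .
  qed
  then have "ennreal (c powr p) * (ennreal (1 / c powr p) * wasserstein_pow p (distr \<mu> borel ((*\<^sub>R) c)) (distr \<nu> borel ((*\<^sub>R) c)))
    \<le> ennreal (c powr p) * wasserstein_pow p \<mu> \<nu>"
    by (rule mult_left_mono) simp
  then show ?thesis
    using c by (simp flip: mult.assoc ennreal_mult)
qed

text \<open>The missing inequality is the previous one applied to the dilated measures with factor
  \<open>1 / c\<close>, which undoes the dilation.\<close>

lemma wasserstein_pow_scale: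
  fixes \<mu> \<nu> :: "'a::euclidean_space measure"
  assumes \<mu>: "sets \<mu> = sets borel" and \<nu>: "sets \<nu> = sets borel" and c: "c > 0"
  shows "wasserstein_pow p (distr \<mu> borel ((*\<^sub>R) c)) (distr \<nu> borel ((*\<^sub>R) c))
    = ennreal (c powr p) * wasserstein_pow p \<mu> \<nu>"
proof (rule antisym)
  let ?W = "wasserstein_pow p (distr \<mu> borel ((*\<^sub>R) c)) (distr \<nu> borel ((*\<^sub>R) c))"
  have inv: "distr (distr \<kappa> borel ((*\<^sub>R) c)) borel ((*\<^sub>R) (1 / c)) = \<kappa>"
    if "sets \<kappa> = sets borel" for \<kappa> :: "'a measure"
  proof -
    have [measurable_cong]: "sets \<kappa> = sets borel" by fact
    show ?thesis using c that by (simp add: distr_distr o_def distr_id2)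
  qed
  have "wasserstein_pow p \<mu> \<nu> \<le> ennreal ((1 / c) powr p) * ?W"
    using wasserstein_pow_scale_le[of "distr \<mu> borel ((*\<^sub>R) c)" "distr \<nu> borel ((*\<^sub>R) c)" "1 / c" p] c
    by (simp add: inv[OF \<mu>] inv[OF \<nu>])
  then have "ennreal (c powr p) * wasserstein_pow p \<mu> \<nu> \<le> ennreal (c powr p) * (ennreal ((1 / c) powr p) * ?W)"
    by (rule mult_left_mono) simp
  also have "\<dots> = ?W"
    using c by (simp add: powr_divide flip: mult.assoc ennreal_mult)
  finally show "ennreal (c powr p) * wasserstein_pow p \<mu> \<nu> \<le> ?W" .
qed (rule wasserstein_pow_scale_le[OF assms])

text \<open>The point mass at \<open>(x, x)\<close> is a coupling of cost zero. This settles the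
  zero direction, where both slices are the point mass at 0.\<close>

lemma wasserstein_pow_return_self [simp]:
  assumes "p \<ge> 1"
  shows "wasserstein_pow p (return borel x) (return borel x) = 0"
proof -
  have "return (borel \<Otimes>\<^sub>M borel) (x, x) \<in> couplings (return borel x) (return borel x)"
    by (auto simp: couplings_def space_prob_algebra distr_return prob_space_return space_pair_measure)
  then have "wasserstein_pow p (return borel x) (return borel x)
    \<le> (\<integral>\<^sup>+ z. ennreal (norm (fst z - snd z) powr p) \<partial>return (borel \<Otimes>\<^sub>M borel) (x, x))"
    unfolding wasserstein_pow_def by (rule INF_lower)
  also have "\<dots> = 0"
    by (subst nn_integral_return) (auto simp: space_pair_measure)
  finally show ?thesis by simp
qed

section \<open>The standard Gaussian measure\<close>

text \<open>The product form reduces the total mass to dimension one; the equivalent radial form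
  \<open>gauss_density_eq\<close> serves wherever orthogonal maps or polar coordinates
  enter.\<close>

definition gauss_density :: "'a::euclidean_space \<Rightarrow> real" where
  "gauss_density x = (\<Prod>b\<in>Basis. std_normal_density (x \<bullet> b))"

definition gauss :: "'a::euclidean_space measure" where
  "gauss = density lborel (\<lambda>x. ennreal (gauss_density x))"

lemma gauss_density_eq:
  fixes x :: "'a::euclidean_space"
  shows "gauss_density x = (1 / sqrt (2 * pi)) ^ DIM('a) * exp (- (norm x)\<^sup>2 / 2)"
proof -
  have "(norm x)\<^sup>2 = (\<Sum>b\<in>Basis. (x \<bullet> b)\<^sup>2)"
    unfolding power2_norm_eq_inner by (subst euclidean_inner) (simp add: power2_eq_square)
  then have "exp (- (norm x)\<^sup>2 / 2) = (\<Prod>b\<in>Basis. exp (- (x \<bullet> b)\<^sup>2 / 2))"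
    by (simp add: sum_negf sum_divide_distrib flip: exp_sum)
  then show ?thesis
    by (simp only: gauss_density_def std_normal_density_def prod.distrib prod_constant)
qed

lemma gauss_density_nonneg [simp]: "gauss_density x \<ge> 0"
  by (simp add: gauss_density_eq)

lemma measurable_gauss_density [measurable]: "gauss_density \<in> borel_measurable borel"
  unfolding gauss_density_def by measurable

lemma sets_gauss [simp, measurable_cong]: "sets gauss = sets borel"
  by (simp add: gauss_def)

lemma space_gauss [simp]: "space gauss = UNIV"
  by (simp add: gauss_def)

lemma nn_integral_gauss:
  "f \<in> borel_measurable borel \<Longrightarrow>
    (\<integral>\<^sup>+ x. f x \<partial>gauss) = (\<integral>\<^sup>+ x. ennreal (gauss_density x) * f x \<partial>lborel)"
  unfolding gauss_def by (rule nn_integral_density) auto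

lemma prob_space_gauss: "prob_space (gauss :: 'a::euclidean_space measure)"
proof
  have std: "(\<integral>\<^sup>+ t. ennreal (std_normal_density t) \<partial>lborel) = 1"
    using prob_space.emeasure_space_1[OF prob_space_normal_density[of 1 0]]
    by (simp add: emeasure_density)
  have "emeasure gauss (space (gauss :: 'a measure)) = (\<integral>\<^sup>+ x. ennreal (gauss_density (x :: 'a)) \<partial>lborel)"
    by (simp add: gauss_def emeasure_density)
  also have "\<dots> = (\<integral>\<^sup>+ x. (\<Prod>b\<in>Basis. ennreal (std_normal_density ((x :: 'a) \<bullet> b))) \<partial>lborel)"
    by (simp add: gauss_density_def flip: prod_ennreal)
  also have "\<dots> = (\<Prod>b\<in>(Basis :: 'a set). \<integral>\<^sup>+ t. ennreal (std_normal_density t) \<partial>lborel)"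
    by (rule nn_integral_lborel_prod[where f="\<lambda>_ t. ennreal (std_normal_density t)"]) auto
  finally show "emeasure gauss (space (gauss :: 'a measure)) = 1"
    by (simp add: std)
qed

lemma nn_integral_lborel_translation:
  fixes c :: "'a::euclidean_space"
  assumes "f \<in> borel_measurable borel"
  shows "(\<integral>\<^sup>+ x. f (c + x) \<partial>lborel) = (\<integral>\<^sup>+ x. f x \<partial>lborel)"
proof -
  have "(\<integral>\<^sup>+ x. f x \<partial>lborel) = (\<integral>\<^sup>+ x. f x \<partial>distr lborel borel ((+) c))"
    by (simp add: lborel_distr_plus)
  also have "\<dots> = (\<integral>\<^sup>+ x. f (c + x) \<partial>lborel)"
    using assms by (intro nn_integral_distr) simp_all
  finally show ?thesis ..
qed

section \<open>Orthogonal projections of Gaussian vectors\<close>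

text \<open>The abstract form of a semi-orthogonal matrix \<open>E = U\<close> with transpose
  \<open>T\<close>: the composite of \<open>T\<close> followed by \<open>E\<close> is the orthogonal
  projection onto the range of \<open>E\<close>.\<close>

locale isometric_embedding =
  fixes E :: "'a::euclidean_space \<Rightarrow> 'b::euclidean_space" and T :: "'b \<Rightarrow> 'a"
  assumes linear_E: "linear E" and linear_T: "linear T"
    and T_E [simp]: "T (E z) = z"
    and adjoint: "E z \<bullet> w = z \<bullet> T w"
begin

lemma measurable_E [measurable]: "E \<in> borel_measurable borel"
  by (intro borel_measurable_continuous_onI linear_continuous_on linear_linear[THEN iffD2] linear_E)

lemma measurable_T [measurable]: "T \<in> borel_measurable borel"
  by (intro borel_measurable_continuous_onI linear_continuous_on linear_linear[THEN iffD2] linear_T)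

text \<open>
  The second component of the orthogonal involution of the product space that exchanges \<open>y\<close> with
  the coordinates \<open>T w\<close> of the projection of \<open>w\<close> onto the range of \<open>E\<close>.
\<close>

definition swap_in :: "'a \<times> 'b \<Rightarrow> 'b" where
  "swap_in = (\<lambda>(y, w). w + E (y - T w))"

lemma measurable_swap_in [measurable]: "swap_in \<in> measurable (borel \<Otimes>\<^sub>M borel) borel"
  unfolding swap_in_def by measurable

lemma T_swap_in: "T (swap_in (y, w)) = y"
  by (simp add: swap_in_def linear_add[OF linear_T])

text \<open>The involution sends \<open>(T w, w - E z)\<close> to \<open>(T w - z, w)\<close>. Being
  orthogonal, it preserves the sum of squared norms, hence the product of the two radial
  densities.\<close>

lemma gauss_density_swap:
  "gauss_density (z + T (w - E z)) * gauss_density (w - E z) = gauss_density (z - T w) * gauss_density w"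
proof -
  have "w \<bullet> E z = z \<bullet> T w" "T w \<bullet> z = z \<bullet> T w"
    by (metis adjoint inner_commute)+
  then have "(norm (T w))\<^sup>2 + (norm (w - E z))\<^sup>2 = (norm (z - T w))\<^sup>2 + (norm w)\<^sup>2"
    by (simp add: power2_norm_eq_inner inner_diff_left inner_diff_right adjoint)
  then have "- (norm (T w))\<^sup>2 / 2 + - (norm (w - E z))\<^sup>2 / 2 = - (norm (z - T w))\<^sup>2 / 2 + - (norm w)\<^sup>2 / 2"
    by linarith
  then have "exp (- (norm (T w))\<^sup>2 / 2) * exp (- (norm (w - E z))\<^sup>2 / 2)
    = exp (- (norm (z - T w))\<^sup>2 / 2) * exp (- (norm w)\<^sup>2 / 2)"
    by (metis exp_add)
  moreover have "z + T (w - E z) = T w"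
    by (simp add: linear_diff[OF linear_T])
  moreover have "(a * b) * (c * d) = (a * c) * (b * d)" for a b c d :: real
    by simp
  ultimately show ?thesis
    by (simp only: gauss_density_eq)
qed

text \<open>Instead of a determinant, the change of variables uses two shears, each of which
  translates one variable while the other is fixed, so that translation invariance of Lebesgue
  measure suffices.\<close>

lemma distr_swap_in: "distr (gauss \<Otimes>\<^sub>M gauss) gauss swap_in = gauss"
proof (rule measure_eqI)
  fix A :: "'b set" assume "A \<in> sets (distr (gauss \<Otimes>\<^sub>M gauss) gauss swap_in)"
  then have [measurable]: "A \<in> sets borel" by simp
  interpret G: prob_space "gauss :: 'b measure" by (rule prob_space_gauss)
  let ?g = "\<lambda>y. ennreal (gauss_density y)" and ?h = "indicator A :: 'b \<Rightarrow> ennreal"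
  have "emeasure (distr (gauss \<Otimes>\<^sub>M gauss) gauss swap_in) A = (\<integral>\<^sup>+ x. ?h x \<partial>distr (gauss \<Otimes>\<^sub>M gauss) gauss swap_in)"
    by simp
  also have "\<dots> = (\<integral>\<^sup>+ x. ?h (swap_in x) \<partial>(gauss \<Otimes>\<^sub>M gauss))"
    by (rule nn_integral_distr) measurable
  also have "\<dots> = (\<integral>\<^sup>+ y. \<integral>\<^sup>+ w. ?h (swap_in (y, w)) \<partial>gauss \<partial>gauss)"
    by (rule G.nn_integral_fst[symmetric]) measurable
  also have "\<dots> = (\<integral>\<^sup>+ y. \<integral>\<^sup>+ w. ?g y * ?g w * ?h (w + E (y - T w)) \<partial>lborel \<partial>lborel)"
    by (simp add: nn_integral_gauss swap_in_def mult.assoc nn_integral_cmult)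
  also have "\<dots> = (\<integral>\<^sup>+ w. \<integral>\<^sup>+ y. ?g y * ?g w * ?h (w + E (y - T w)) \<partial>lborel \<partial>lborel)"
    by (rule lborel_pair.Fubini') measurable
  \<comment> \<open>First shear: \<open>y = T w + z\<close> with \<open>w\<close> fixed.\<close>
  also have "\<dots> = (\<integral>\<^sup>+ w. \<integral>\<^sup>+ z. ?g (T w + z) * ?g w * ?h (w + E z) \<partial>lborel \<partial>lborel)"
  proof (rule nn_integral_cong)
    fix w :: 'b
    have "(\<integral>\<^sup>+ y. ?g y * ?g w * ?h (w + E (y - T w)) \<partial>lborel)
      = (\<integral>\<^sup>+ z. ?g (T w + z) * ?g w * ?h (w + E ((T w + z) - T w)) \<partial>lborel)"
      by (rule nn_integral_lborel_translation[symmetric]) measurable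
    then show "(\<integral>\<^sup>+ y. ?g y * ?g w * ?h (w + E (y - T w)) \<partial>lborel)
      = (\<integral>\<^sup>+ z. ?g (T w + z) * ?g w * ?h (w + E z) \<partial>lborel)"
      by simp
  qed
  also have "\<dots> = (\<integral>\<^sup>+ z. \<integral>\<^sup>+ w. ?g (T w + z) * ?g w * ?h (w + E z) \<partial>lborel \<partial>lborel)"
    by (rule lborel_pair.Fubini'[symmetric]) measurable
  \<comment> \<open>Second shear: \<open>w\<close> is replaced by \<open>w - E z\<close> with
    \<open>z\<close> fixed. The indicator then depends on \<open>w\<close> alone, and
    \<open>z\<close> can be integrated out.\<close>
  also have "\<dots> = (\<integral>\<^sup>+ z. \<integral>\<^sup>+ w. ?g (z - T w) * ?g w * ?h w \<partial>lborel \<partial>lborel)"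
  proof (rule nn_integral_cong)
    fix z :: 'a
    have "(\<integral>\<^sup>+ w. ?g (T w + z) * ?g w * ?h (w + E z) \<partial>lborel)
       = (\<integral>\<^sup>+ w. ?g (T (- E z + w) + z) * ?g (- E z + w) * ?h ((- E z + w) + E z) \<partial>lborel)"
      by (rule nn_integral_lborel_translation[symmetric]) measurable
    also have "\<dots> = (\<integral>\<^sup>+ w. ?g (z - T w) * ?g w * ?h w \<partial>lborel)"
      using gauss_density_swap[of z]
      by (intro nn_integral_cong) (simp add: add.commute flip: ennreal_mult)
    finally show "(\<integral>\<^sup>+ w. ?g (T w + z) * ?g w * ?h (w + E z) \<partial>lborel)
      = (\<integral>\<^sup>+ w. ?g (z - T w) * ?g w * ?h w \<partial>lborel)" .
  qed
  also have "\<dots> = (\<integral>\<^sup>+ w. \<integral>\<^sup>+ z. ?g (z - T w) * ?g w * ?h w \<partial>lborel \<partial>lborel)"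
    by (rule lborel_pair.Fubini') measurable
  also have "\<dots> = (\<integral>\<^sup>+ w. ?g w * ?h w \<partial>lborel)"
  proof (rule nn_integral_cong)
    fix w :: 'b
    have "(\<integral>\<^sup>+ z. ?g (z - T w) * ?g w * ?h w \<partial>lborel) = (\<integral>\<^sup>+ z. ?g (- T w + z) \<partial>lborel) * (?g w * ?h w)"
      by (simp add: mult.assoc nn_integral_multc)
    also have "(\<integral>\<^sup>+ z. ?g (- T w + z) \<partial>lborel) = (\<integral>\<^sup>+ z. ?g (z :: 'a) \<partial>lborel)"
      by (rule nn_integral_lborel_translation) measurable
    also have "\<dots> = 1"
      using prob_space.emeasure_space_1[OF prob_space_gauss]
      by (simp add: gauss_def emeasure_density)
    finally show "(\<integral>\<^sup>+ z. ?g (z - T w) * ?g w * ?h w \<partial>lborel) = ?g w * ?h w"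
      by simp
  qed
  also have "\<dots> = emeasure gauss A"
    by (subst nn_integral_gauss[symmetric]) simp_all
  finally show "emeasure (distr (gauss \<Otimes>\<^sub>M gauss) gauss swap_in) A = emeasure gauss A" .
qed simp

text \<open>A Gaussian vector has the law of \<open>swap_in (y, w)\<close> for independent Gaussian
  \<open>y\<close> and \<open>w\<close>, and \<open>T\<close> recovers \<open>y\<close> from
  it.\<close>

lemma distr_gauss_T: "distr gauss gauss T = gauss"
proof -
  interpret G: prob_space "gauss :: 'b measure" by (rule prob_space_gauss)
  have "distr gauss gauss T = distr (distr (gauss \<Otimes>\<^sub>M gauss) gauss swap_in) gauss T"
    by (simp add: distr_swap_in)
  also have "\<dots> = distr (gauss \<Otimes>\<^sub>M gauss) gauss (T \<circ> swap_in)"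
    by (rule distr_distr) measurable
  also have "T \<circ> swap_in = (fst :: 'a \<times> 'b \<Rightarrow> 'a)"
    by (simp add: fun_eq_iff T_swap_in)
  also have "distr (gauss \<Otimes>\<^sub>M (gauss :: 'b measure)) gauss fst = (gauss :: 'a measure)"
    by (rule G.distr_pair_fst)
  finally show ?thesis .
qed

end

section \<open>Polar decomposition of the Gaussian measure\<close>

lemma emeasure_cone_ball:
  fixes C :: "'a::euclidean_space set"
  assumes C[measurable]: "C \<in> sets borel"
    and cone: "\<And>c x. c > 0 \<Longrightarrow> c *\<^sub>R x \<in> C \<longleftrightarrow> x \<in> C" and r: "r > 0"
  shows "emeasure lborel (C \<inter> ball 0 r) = ennreal (r ^ DIM('a)) * emeasure lborel (C \<inter> ball 0 1)"
proof -
  have "emeasure lborel (C \<inter> ball 0 r)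
    = emeasure (density (distr lborel borel (\<lambda>x. 0 + r *\<^sub>R x)) (\<lambda>_. ennreal (\<bar>r\<bar> ^ DIM('a)))) (C \<inter> ball 0 r)"
    using lborel_affine[of r "0 :: 'a"] r by simp
  also have "\<dots> = ennreal (r ^ DIM('a)) * emeasure (distr lborel borel (\<lambda>x. 0 + r *\<^sub>R x)) (C \<inter> ball 0 r)"
    using r by (subst emeasure_density_const) auto
  also have "emeasure (distr lborel borel (\<lambda>x. 0 + r *\<^sub>R x)) (C \<inter> ball 0 r)
    = emeasure lborel ((\<lambda>x. 0 + r *\<^sub>R x) -` (C \<inter> ball 0 r) \<inter> space lborel)"
    by (rule emeasure_distr) auto
  also have "(\<lambda>x. 0 + r *\<^sub>R x) -` (C \<inter> ball 0 r) \<inter> space lborel = C \<inter> ball 0 1"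
    using r cone[of r] by (auto simp: dist_norm)
  finally show ?thesis .
qed

text \<open>The volumes of the ball and of its part in the cone scale by the same power of
  \<open>r\<close>, so the fraction filled by the cone is the one seen in the unit ball.\<close>

lemma emeasure_uniform_cone_ball:
  fixes C :: "'a::euclidean_space set"
  assumes "C \<in> sets borel" "\<And>c x. c > 0 \<Longrightarrow> c *\<^sub>R x \<in> C \<longleftrightarrow> x \<in> C" "r > 0"
  shows "emeasure lborel (C \<inter> ball 0 r)
    = emeasure (uniform_measure lborel (ball 0 1)) C * emeasure lborel (ball (0::'a) r)"
proof -
  have fin: "emeasure lborel (ball (0::'a) 1) \<noteq> \<infinity>" "emeasure lborel (ball (0::'a) 1) \<noteq> 0"
    using unit_ball_vol_pos[of "real DIM('a)"] by (simp_all add: emeasure_ball less_imp_neq[THEN not_sym])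
  have "emeasure lborel (C \<inter> ball 0 r) = ennreal (r ^ DIM('a)) * emeasure lborel (C \<inter> ball 0 1)"
    by (intro emeasure_cone_ball assms)
  also have "emeasure lborel (C \<inter> ball 0 1)
    = emeasure (uniform_measure lborel (ball 0 1)) C * emeasure lborel (ball (0::'a) 1)"
    using assms(1) fin
    by (simp add: Int_commute ennreal_divide_times top.not_eq_extremum)
  finally show ?thesis
    using emeasure_cone_ball[of "UNIV :: 'a set" r] assms(3) by (simp add: mult.left_commute)
qed

text \<open>This is the independence of direction and length for Lebesgue measure, with no surface
  measure involved. It is checked on the half-lines \<open>{..<r}\<close>, whose preimages under the
  norm are balls.\<close>

lemma distr_cone_norm:
  fixes C :: "'a::euclidean_space set"
  assumes C[measurable]: "C \<in> sets borel"
    and cone: "\<And>c x. c > 0 \<Longrightarrow> c *\<^sub>R x \<in> C \<longleftrightarrow> x \<in> C"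
  shows "distr (density lborel (indicator C)) borel norm
    = density (distr lborel borel (norm :: 'a \<Rightarrow> real)) (\<lambda>_. emeasure (uniform_measure lborel (ball 0 1)) C)"
proof -
  let ?M = "distr (density lborel (indicator C)) borel norm"
  let ?N = "density (distr lborel borel (norm :: 'a \<Rightarrow> real)) (\<lambda>_. emeasure (uniform_measure lborel (ball 0 1)) C)"
  have vimage: "norm -` {..<r} = ball (0::'a) r" for r
    by (auto simp: dist_norm)
  have M: "emeasure ?M {..<r} = emeasure lborel (C \<inter> ball 0 r)" for r
    by (simp add: emeasure_distr emeasure_density vimage flip: indicator_inter_arith)
  have N: "emeasure ?N {..<r} = emeasure (uniform_measure lborel (ball 0 1)) C * emeasure lborel (ball (0::'a) r)" for r
    by (simp add: emeasure_density_const emeasure_distr vimage del: emeasure_uniform_measure)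
  show ?thesis
  proof (rule measure_eqI_generator_eq[where E="range lessThan" and \<Omega>=UNIV and A="\<lambda>n. {..<real n}"])
    show "Int_stable (range (lessThan :: real \<Rightarrow> real set))"
    proof (rule Int_stableI, clarify)
      fix a b :: real
      have "{..<a} \<inter> {..<b} = {..<min a b}" by auto
      then show "{..<a} \<inter> {..<b} \<in> range lessThan" by simp
    qed
    show "emeasure ?M X = emeasure ?N X" if "X \<in> range lessThan" for X
    proof -
      obtain r where X: "X = {..<r}" using \<open>X \<in> range lessThan\<close> by auto
      show ?thesis
      proof (cases "r > 0")
        case True
        then show ?thesis
          unfolding X M N by (intro emeasure_uniform_cone_ball C cone)
      next
        case False
        then show ?thesis
          unfolding X M N by (simp add: ball_empty)
      qed
    qed
    show "emeasure ?M {..<real n} \<noteq> \<infinity>" for n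
    proof -
      have "emeasure ?M {..<real n} \<le> emeasure lborel (ball (0::'a) (real n))"
        unfolding M by (rule emeasure_mono) auto
      also have "\<dots> < \<infinity>" by (rule emeasure_lborel_ball_finite)
      finally show ?thesis by simp
    qed
    show "(\<Union>n. {..<real n}) = UNIV"
      using reals_Archimedean2 by auto
  qed (auto simp: borel_Iio)
qed

lemma sets_uniform_sphere [simp, measurable_cong]:
  "sets uniform_sphere = sets (borel :: (real^'m) measure)"
  by (simp add: uniform_sphere_def)

text \<open>The Gaussian density depends on the norm only, so the Lebesgue statement for cones
  passes to it: direction and length are independent and the direction is uniform.\<close>

lemma distr_gauss_sgn_norm:
  "distr gauss borel (sgn :: real^'m \<Rightarrow> _) = uniform_sphere"
  "uniform_sphere \<Otimes>\<^sub>M distr gauss borel (norm :: real^'m \<Rightarrow> _)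
    = distr gauss (borel \<Otimes>\<^sub>M borel) (\<lambda>x. (sgn x :: real^'m, norm x))"
proof -
  interpret G: prob_space "gauss :: (real^'m) measure" by (rule prob_space_gauss)
  have rect: "emeasure gauss {x. sgn x \<in> A \<and> norm x \<in> B}
    = emeasure uniform_sphere A * emeasure (distr gauss borel (norm :: real^'m \<Rightarrow> _)) B"
    if [measurable]: "A \<in> sets borel" "B \<in> sets borel" for A :: "(real^'m) set" and B :: "real set"
  proof -
    \<comment> \<open>Positive scaling does not change \<open>sgn\<close>, so the vectors with
      direction in \<open>A\<close> form a cone.\<close>
    let ?C = "sgn -` A :: (real^'m) set"
    let ?b = "emeasure (uniform_measure lborel (ball 0 1)) ?C"
    let ?\<phi> = "\<lambda>t. ennreal ((1 / sqrt (2 * pi)) ^ CARD('m) * exp (- t\<^sup>2 / 2)) * indicator B t"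
    have [measurable]: "?C \<in> sets borel"
      using measurable_sets[OF borel_measurable_sgn, of A] by simp
    have b: "emeasure uniform_sphere A = ?b"
      unfolding uniform_sphere_def by (subst emeasure_distr) (auto simp: sgn_div_norm vimage_def)
    have \<phi>: "ennreal (gauss_density x) * indicator B (norm x) = ?\<phi> (norm x)" for x :: "real^'m"
      by (simp add: gauss_density_eq)
    have "emeasure gauss {x. sgn x \<in> A \<and> norm x \<in> B}
      = (\<integral>\<^sup>+ x. indicator ?C x * ?\<phi> (norm x) \<partial>lborel)"
      by (subst nn_integral_indicator[symmetric], measurable, subst nn_integral_gauss)
        (auto intro!: nn_integral_cong simp: gauss_density_eq split: split_indicator)
    also have "\<dots> = (\<integral>\<^sup>+ t. ?\<phi> t \<partial>distr (density lborel (indicator ?C)) borel norm)"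
      by (simp add: nn_integral_distr nn_integral_density)
    also have "distr (density lborel (indicator ?C)) borel norm
      = density (distr lborel borel (norm :: real^'m \<Rightarrow> real)) (\<lambda>_. ?b)"
      by (rule distr_cone_norm) (auto simp: sgn_scaleR)
    also have "(\<integral>\<^sup>+ t. ?\<phi> t \<partial>\<dots>) = ?b * (\<integral>\<^sup>+ x. ?\<phi> (norm x) \<partial>(lborel :: (real^'m) measure))"
      by (simp add: nn_integral_distr nn_integral_density nn_integral_cmult)
    also have "(\<integral>\<^sup>+ x. ?\<phi> (norm x) \<partial>(lborel :: (real^'m) measure)) = (\<integral>\<^sup>+ x. indicator B (norm x) \<partial>(gauss :: (real^'m) measure))"
      by (subst nn_integral_gauss) (auto simp: gauss_density_eq)
    also have "\<dots> = emeasure (distr gauss borel (norm :: real^'m \<Rightarrow> _)) B"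
      by (subst nn_integral_distr[of norm gauss borel "indicator B", symmetric]) simp_all
    finally show ?thesis unfolding b .
  qed
  show sgn: "distr gauss borel (sgn :: real^'m \<Rightarrow> _) = uniform_sphere"
  proof (rule measure_eqI)
    fix A assume "A \<in> sets (distr gauss borel (sgn :: real^'m \<Rightarrow> _))"
    then show "emeasure (distr gauss borel sgn) A = emeasure uniform_sphere A"
      \<comment> \<open>With no constraint on the length, the second factor is the total mass
        1.\<close>
      using rect[of A UNIV] G.emeasure_space_1 by (simp add: emeasure_distr vimage_def)
  qed simp
  show "uniform_sphere \<Otimes>\<^sub>M distr gauss borel (norm :: real^'m \<Rightarrow> _)
    = distr gauss (borel \<Otimes>\<^sub>M borel) (\<lambda>x. (sgn x :: real^'m, norm x))"
  proof (rule pair_measure_eqI)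
    interpret S: prob_space "uniform_sphere :: (real^'m) measure"
      unfolding sgn[symmetric] by (rule G.prob_space_distr) measurable
    interpret N: prob_space "distr gauss borel (norm :: real^'m \<Rightarrow> _)"
      by (rule G.prob_space_distr) measurable
    show "sigma_finite_measure (uniform_sphere :: (real^'m) measure)" ..
    show "sigma_finite_measure (distr gauss borel (norm :: real^'m \<Rightarrow> _))" ..
    fix A :: "(real^'m) set" and B :: "real set"
    assume "A \<in> sets uniform_sphere" and "B \<in> sets (distr gauss borel (norm :: real^'m \<Rightarrow> _))"
    then have [measurable]: "A \<in> sets borel" "B \<in> sets borel" by auto
    show "emeasure uniform_sphere A * emeasure (distr gauss borel (norm :: real^'m \<Rightarrow> _)) B
      = emeasure (distr gauss (borel \<Otimes>\<^sub>M borel) (\<lambda>x. (sgn x, norm x))) (A \<times> B)"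
      by (subst emeasure_distr) (auto simp: rect[symmetric] vimage_def)
  qed (simp cong: sets_pair_measure_cong)
qed

lemma AE_gauss_nonzero: "AE x in gauss. x \<noteq> 0"
  unfolding gauss_def by (subst AE_density) (auto intro: eventually_mono[OF AE_lborel_singleton])

text \<open>\<open>uniform_sphere\<close> lives on the ambient space; this removes the restriction
  to the sphere from the rescaled integral.\<close>

lemma AE_uniform_sphere: "AE \<theta> in (uniform_sphere :: (real^'m) measure). \<theta> \<in> sphere 0 1"
proof -
  have "AE x in gauss. sgn x \<in> sphere (0 :: real^'m) 1"
    using AE_gauss_nonzero by eventually_elim (simp add: norm_sgn)
  then show ?thesis
    unfolding distr_gauss_sgn_norm(1)[symmetric]
    by (subst AE_distr_iff) simp_all
qed

lemma norm_scaleR_sgn: "norm x *\<^sub>R sgn x = x"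
  by (cases "x = 0") (simp_all add: sgn_div_norm)

text \<open>The fibre of \<open>sgn\<close> over a unit vector \<open>y\<close> is the open ray
  through \<open>y\<close>. By independence it is filled by \<open>t *\<^sub>R y\<close> with
  \<open>t\<close> distributed as the Gaussian norm, which is almost surely positive.\<close>

lemma nn_integral_uniform_sphere:
  "(\<integral>\<^sup>+ x. F (sgn x) \<partial>gauss) = (\<integral>\<^sup>+ \<theta>. F \<theta> \<partial>(uniform_sphere :: (real^'m) measure))"
proof (rule nn_integral_distr_section[where s="\<lambda>(y, t). t *\<^sub>R y" and P="distr gauss borel (norm :: real^'m \<Rightarrow> _)"])
  let ?P = "distr gauss borel (norm :: real^'m \<Rightarrow> _)"
  show "sgn \<in> measurable gauss (uniform_sphere :: (real^'m) measure)"
    by measurable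
  show "distr gauss uniform_sphere sgn = (uniform_sphere :: (real^'m) measure)"
    unfolding distr_gauss_sgn_norm(1)[symmetric] by (rule distr_cong) simp_all
  show "prob_space ?P"
    by (rule prob_space.prob_space_distr[OF prob_space_gauss]) measurable
  show "(\<lambda>(y, t). t *\<^sub>R y) \<in> measurable (uniform_sphere \<Otimes>\<^sub>M ?P) (gauss :: (real^'m) measure)"
    by measurable
  have "distr (uniform_sphere \<Otimes>\<^sub>M ?P) gauss (\<lambda>(y, t). t *\<^sub>R y)
    = distr gauss gauss ((\<lambda>(y, t). t *\<^sub>R y) \<circ> (\<lambda>x::real^'m. (sgn x, norm x)))"
    unfolding distr_gauss_sgn_norm(2) by (rule distr_distr) measurable
  also have "(\<lambda>(y, t). t *\<^sub>R y) \<circ> (\<lambda>x::real^'m. (sgn x, norm x)) = (\<lambda>x. x)"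
    by (simp add: fun_eq_iff norm_scaleR_sgn)
  finally show "distr (uniform_sphere \<Otimes>\<^sub>M ?P) gauss (\<lambda>(y, t). t *\<^sub>R y) = (gauss :: (real^'m) measure)"
    by (simp add: distr_id)
  have "AE x in gauss. norm (x :: real^'m) > 0"
    using AE_gauss_nonzero by eventually_elim simp
  then have pos: "AE t in ?P. t > 0"
    by (subst AE_distr_iff) simp_all
  show "AE y in uniform_sphere. AE t in ?P. sgn (case (y, t) of (y, t) \<Rightarrow> t *\<^sub>R y) = (y :: real^'m)"
    using AE_uniform_sphere
  proof eventually_elim
    fix y :: "real^'m" assume "y \<in> sphere 0 1"
    then have "sgn (t *\<^sub>R y) = y" if "t > 0" for t
      using that by (simp add: sgn_scaleR sgn_div_norm[of y])
    with pos show "AE t in ?P. sgn (case (y, t) of (y, t) \<Rightarrow> t *\<^sub>R y) = y"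
      by (auto elim: eventually_mono)
  qed
qed

text \<open>Here \<open>swap_in\<close> parametrises the fibres of \<open>T\<close>: for fixed
  \<open>y\<close>, every \<open>swap_in (y, w)\<close> lies over \<open>y\<close>.\<close>

lemma (in isometric_embedding) nn_integral_gauss_T:
  "(\<integral>\<^sup>+ w. F (T w) \<partial>gauss) = (\<integral>\<^sup>+ y. F y \<partial>gauss)"
  by (rule nn_integral_distr_section[OF _ distr_gauss_T prob_space_gauss _ distr_swap_in])
    (simp_all add: T_swap_in, measurable)

section \<open>Slices of projected measures\<close>

text \<open>The convention for a vanishing projection is exactly \<open>sgn 0 = 0\<close>.\<close>

lemma project_direction_eq_sgn: "project_direction U \<theta> = sgn (transpose U *v \<theta>)"
  by (simp add: project_direction_def sgn_div_norm)

lemma slice_scaleR: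
  assumes "sets \<kappa> = sets borel"
  shows "slice (c *\<^sub>R \<theta>) \<kappa> = distr (slice \<theta> \<kappa>) borel ((*\<^sub>R) c)"
proof -
  have [measurable_cong]: "sets \<kappa> = sets borel" by fact
  show ?thesis
    by (simp add: slice_def distr_distr o_def)
qed

lemma slice_zero:
  fixes \<kappa> :: "(real ^ 'm) measure"
  assumes "prob_space \<kappa>"
  shows "slice 0 \<kappa> = return borel 0"
proof -
  have "(\<lambda>x. 0 \<bullet> x) = (\<lambda>_::real^'m. 0)" by (simp add: fun_eq_iff)
  then show ?thesis
    using prob_space.distr_const[OF assms, of 0 borel] by (simp add: slice_def)
qed

lemma wasserstein_pow_slice_scaleR:
  assumes \<mu>: "\<mu> \<in> space (prob_algebra borel)" and \<nu>: "\<nu> \<in> space (prob_algebra borel)"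
    and p: "p \<ge> 1" and c: "c \<ge> 0"
  shows "wasserstein_pow p (slice (c *\<^sub>R \<theta>) \<mu>) (slice (c *\<^sub>R \<theta>) \<nu>)
    = ennreal (c powr p) * wasserstein_pow p (slice \<theta> \<mu>) (slice \<theta> \<nu>)"
proof (cases "c = 0")
  \<comment> \<open>Both slices are the point mass at 0, so the left side vanishes; so does the
    right, even for infinite cost, since 0 times infinity is 0 in \<open>ennreal\<close>.\<close>
  case True
  then show ?thesis using \<mu> \<nu> p by (simp add: slice_zero space_prob_algebra)
next
  case False
  have sets: "sets \<mu> = sets borel" "sets \<nu> = sets borel"
    using \<mu> \<nu> by (simp_all add: space_prob_algebra)
  show ?thesis
    unfolding slice_scaleR[OF sets(1)] slice_scaleR[OF sets(2)]
    using False c by (intro wasserstein_pow_scale) (simp_all add: slice_def)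
qed

text \<open>The invariance says that the measure is its own image under the projection onto the
  column span; moving \<open>U\<close> to the other side of the inner product then turns
  \<open>\<theta>\<close> into its projected coordinates.\<close>

lemma slice_project_coords:
  fixes U :: "real ^ 'k ^ 'd"
  assumes \<mu>: "sets \<mu> = sets borel"
    and inv: "\<And>A. A \<in> sets borel \<Longrightarrow> emeasure \<mu> A = emeasure \<mu> ((\<lambda>x. U *v (transpose U *v x)) -` A)"
  shows "slice \<theta> \<mu> = slice (transpose U *v \<theta>) (project_coords U \<mu>)"
proof -
  have [measurable_cong]: "sets \<mu> = sets borel" by fact
  have [measurable]: "(*v) A \<in> borel_measurable borel" for A :: "real ^ 'n ^ 'm"
    by (intro borel_measurable_continuous_onI linear_continuous_on linear_linear[THEN iffD2] matrix_vector_mul_linear)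
  have [measurable]: "(\<lambda>x. U *v (transpose U *v x)) \<in> borel_measurable borel"
     "(\<lambda>x. transpose U *v x) \<in> borel_measurable borel"
    by measurable
  have "distr \<mu> borel (\<lambda>x. U *v (transpose U *v x)) = \<mu>"
    using sets_eq_imp_space_eq[OF \<mu>]
    by (intro measure_eqI)
      (simp_all add: \<mu> emeasure_distr inv[symmetric] del: transpose_matrix_vector)
  then have "slice \<theta> \<mu> = slice \<theta> (distr \<mu> borel (\<lambda>x. U *v (transpose U *v x)))"
    by simp
  also have "\<dots> = distr \<mu> borel (\<lambda>x. \<theta> \<bullet> (U *v (transpose U *v x)))"
    unfolding slice_def by (subst distr_distr) (simp_all add: o_def del: transpose_matrix_vector)
  also have "(\<lambda>x. \<theta> \<bullet> (U *v (transpose U *v x))) = (\<lambda>x. (transpose U *v \<theta>) \<bullet> (transpose U *v x))"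
    by (simp add: dot_lmul_matrix)
  also have "distr \<mu> borel \<dots> = slice (transpose U *v \<theta>) (project_coords U \<mu>)"
    unfolding slice_def project_coords_def
    by (subst distr_distr) (simp_all add: o_def)
  finally show ?thesis .
qed

theorem proposition4p7:
  fixes p :: real
    and \<mu> \<nu> :: "(real ^ 'd) measure"
    and U :: "real ^ 'k ^ 'd"
  assumes "p \<ge> 1"
    and "\<mu> \<in> space (prob_algebra borel)"
    and "\<nu> \<in> space (prob_algebra borel)"
    and "effective_structure p \<mu> \<nu> U"
  shows "(\<forall>\<theta>\<in>sphere 0 1.
            wasserstein_pow p (slice \<theta> \<mu>) (slice \<theta> \<nu>) =
              wasserstein_pow p (slice (transpose U *v \<theta>) (project_coords U \<mu>))
                                (slice (transpose U *v \<theta>) (project_coords U \<nu>)) \<and>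
            wasserstein_pow p (slice (transpose U *v \<theta>) (project_coords U \<mu>))
                              (slice (transpose U *v \<theta>) (project_coords U \<nu>)) =
              ennreal (norm (transpose U *v \<theta>) powr p) *
              wasserstein_pow p (slice (project_direction U \<theta>) (project_coords U \<mu>))
                                (slice (project_direction U \<theta>) (project_coords U \<nu>))) \<and>
         (\<forall>L \<theta>. L \<ge> 1 \<longrightarrow> (\<forall>l\<in>{1..L}. \<theta> l \<in> sphere 0 1) \<longrightarrow>
            sliced_wasserstein_pow p (project_coords U \<mu>) (project_coords U \<nu>)
                (empirical L (\<lambda>l. project_direction U (\<theta> l))) =
              rescaled_sliced_wasserstein_pow p U \<mu> \<nu> (empirical L \<theta>) (rescaling p)) \<and>
         sliced_wasserstein_pow p (project_coords U \<mu>) (project_coords U \<nu>) uniform_sphere =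
           rescaled_sliced_wasserstein_pow p U \<mu> \<nu> uniform_sphere (rescaling p)"
proof -
  let ?F = "\<lambda>\<phi>. wasserstein_pow p (slice \<phi> (project_coords U \<mu>)) (slice \<phi> (project_coords U \<nu>))"
  let ?W = "\<lambda>\<theta>. wasserstein_pow p (slice \<theta> \<mu>) (slice \<theta> \<nu>)"
  let ?R = "\<lambda>\<theta>. ennreal (rescaling p (norm (transpose U *v \<theta>))) * ?W \<theta>"
  have sets: "sets \<mu> = sets borel" "sets \<nu> = sets borel" and prob: "prob_space \<mu>" "prob_space \<nu>"
    using assms(2,3) by (simp_all add: space_prob_algebra)
  have UU: "transpose U ** U = mat 1"
    and inv: "\<And>A. A \<in> sets borel \<Longrightarrow> emeasure \<mu> A = emeasure \<mu> ((\<lambda>x. U *v (transpose U *v x)) -` A)"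
      "\<And>A. A \<in> sets borel \<Longrightarrow> emeasure \<nu> A = emeasure \<nu> ((\<lambda>x. U *v (transpose U *v x)) -` A)"
    using assms(4) unfolding effective_structure_def by blast+
  interpret isometric_embedding "(*v) U" "(*v) (transpose U)"
  proof
    show "transpose U *v (U *v z) = z" for z
      by (simp only: matrix_vector_mul_assoc UU matrix_vector_mul_lid)
    show "(U *v z) \<bullet> w = z \<bullet> (transpose U *v w)" for z w
      using dot_lmul_matrix[of z "transpose U" w] by (simp only: vector_transpose_matrix)
  qed (simp_all only: matrix_vector_right_distrib matrix_vector_mult_scaleR)
  have coords: "project_coords U \<kappa> \<in> space (prob_algebra borel)"
    if "sets \<kappa> = sets borel" "prob_space \<kappa>" for \<kappa>
  proof -
    have [measurable_cong]: "sets \<kappa> = sets borel" by fact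
    show ?thesis
      unfolding project_coords_def space_prob_algebra
      by (simp add: prob_space.prob_space_distr[OF that(2)] del: transpose_matrix_vector)
  qed
  have eq1: "?W \<theta> = ?F (transpose U *v \<theta>)" for \<theta>
    by (simp only: slice_project_coords[OF sets(1) inv(1)] slice_project_coords[OF sets(2) inv(2)])
  have eq2: "?F (transpose U *v \<theta>) = ennreal (norm (transpose U *v \<theta>) powr p) * ?F (project_direction U \<theta>)" for \<theta>
  proof -
    have "transpose U *v \<theta> = norm (transpose U *v \<theta>) *\<^sub>R project_direction U \<theta>"
      unfolding project_direction_eq_sgn by (rule norm_scaleR_sgn[symmetric])
    then show ?thesis
      using wasserstein_pow_slice_scaleR[OF coords[OF sets(1) prob(1)] coords[OF sets(2) prob(2)] assms(1) norm_ge_zero]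
      by metis
  qed
  have F0: "?F 0 = 0"
    using wasserstein_pow_slice_scaleR[OF coords[OF sets(1) prob(1)] coords[OF sets(2) prob(2)] assms(1), of 0 0]
    by simp
  \<comment> \<open>This pointwise identity drives both integral claims: the rescaled integrand is
    the cost of the low-dimensional slices along the projected direction. If the projection is 0,
    both sides are 0 by \<open>F0\<close>.\<close>
  have R: "?R \<theta> = ?F (project_direction U \<theta>)" for \<theta>
  proof (cases "transpose U *v \<theta> = 0")
    case True
    then show ?thesis
      unfolding eq1 project_direction_eq_sgn by (simp only: F0 sgn_zero mult_zero_right)
  next
    case False
    then have pos: "norm (transpose U *v \<theta>) > 0" by (simp only: zero_less_norm_iff) simp
    then have "ennreal (rescaling p (norm (transpose U *v \<theta>))) * ennreal (norm (transpose U *v \<theta>) powr p) = 1"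
      by (simp add: rescaling_def flip: ennreal_mult powr_add)
    then show ?thesis
      unfolding eq1 eq2 by (simp only: mult.assoc[symmetric] mult_1_left)
  qed
  have "sliced_wasserstein_pow p (project_coords U \<mu>) (project_coords U \<nu>)
          (empirical L (\<lambda>l. project_direction U (\<theta> l)))
      = rescaled_sliced_wasserstein_pow p U \<mu> \<nu> (empirical L \<theta>) (rescaling p)"
    if "\<forall>l\<in>{1..L}. \<theta> l \<in> sphere 0 1" for L \<theta>
    \<comment> \<open>Both sides become averages over the indices, and every
      \<open>\<theta> l\<close> is on the sphere, so the indicator there is 1.\<close>
    unfolding sliced_wasserstein_pow_def rescaled_sliced_wasserstein_pow_def nn_integral_empirical R
    using that by (intro nn_integral_cong) (simp add: space_uniform_count_measure)
  moreover have "sliced_wasserstein_pow p (project_coords U \<mu>) (project_coords U \<nu>) uniform_sphere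
      = rescaled_sliced_wasserstein_pow p U \<mu> \<nu> uniform_sphere (rescaling p)"
  proof -
    \<comment> \<open>Normalising before projecting does not change the projected direction, so a
      uniform direction can be replaced by a Gaussian vector.\<close>
    have sgn: "project_direction U (sgn w) = sgn (transpose U *v w)" for w
    proof (cases "w = 0")
      case False
      then show ?thesis
        unfolding project_direction_eq_sgn sgn_div_norm[of w] matrix_vector_mult_scaleR sgn_scaleR
        by simp
    qed (simp add: project_direction_eq_sgn)
    have "rescaled_sliced_wasserstein_pow p U \<mu> \<nu> uniform_sphere (rescaling p)
      = (\<integral>\<^sup>+ \<theta>. ?F (project_direction U \<theta>) \<partial>uniform_sphere)"
      unfolding rescaled_sliced_wasserstein_pow_def R using AE_uniform_sphere
      by (intro nn_integral_cong_AE, eventually_elim) simp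
    also have "\<dots> = (\<integral>\<^sup>+ w. ?F (sgn (transpose U *v w)) \<partial>gauss)"
      by (simp only: sgn flip: nn_integral_uniform_sphere)
    \<comment> \<open>The dimension drops here: the Gaussian measure on the large space is exchanged
      for the one on the coordinate space.\<close>
    also have "\<dots> = (\<integral>\<^sup>+ y. ?F (sgn y) \<partial>gauss)"
      by (rule nn_integral_gauss_T)
    also have "\<dots> = (\<integral>\<^sup>+ \<phi>. ?F \<phi> \<partial>uniform_sphere)"
      by (rule nn_integral_uniform_sphere)
    finally show ?thesis
      unfolding sliced_wasserstein_pow_def by (rule sym)
  qed
  ultimately show ?thesis
    using eq1 eq2 by blast
qed

end
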